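(* Let $X\in\mathbb{R}^{d_1\times\cdots\times d_k}$ be a $k$th order tensor and let $\delta=(\delta_1,\dots,\delta_k)\in(0,1]^k$ satisfy $\delta_j\ge\max_{\|u\|_{\ell_2}\le1}\|P_j(X)u\|_{\ell_\infty}$ for $j=1,\dots,k$. Then there exists $W_0\in\mathbb{R}^{d_1\times\cdots\times d_k}$ such that $$\mathcal{Q}_X^0W_0=W_0,\qquad\|W_0\|_{\circ,\delta}=1,\qquad\text{and}\qquad\|X\|_{\star,\delta}=\langle W_0,X\rangle.$$ Moreover, for any $Y\in\mathbb{R}^{d_1\times\cdots\times d_k}$, $$\|Y\|_{\star,\delta}\ge\|X\|_{\star,\delta}+\frac{2}{k(k-1)}\|\mathcal{Q}_X^\perp Y\|_{\star,\delta}+\langle W_0,Y-X\rangle.$$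
   Context: $\langle\cdot,\cdot\rangle$ is the entrywise (vectorized) inner product on $\mathbb{R}^{d_1\times\cdots\times d_k}$. For $\delta\in(0,1]^k$ and $1\le j_1<j_2\le k$ let $$\mathscr{U}_{j_1j_2}(\delta)=\{u_1\otimes\cdots\otimes u_k:\ u_j\in\mathbb{R}^{d_j},\ \|u_j\|_{\ell_2}\le1\ \forall j;\ \|u_j\|_{\ell_\infty}\le\delta_j\ \forall j\ne j_1,j_2\},$$ $\mathscr{U}(\delta)=\bigcup_{1\le j_1<j_2\le k}\mathscr{U}_{j_1j_2}(\delta)$, $\|X\|_{\circ,\delta}=\sup_{Y\in\mathscr{U}(\delta)}\langle Y,X\rangle$ (incoherent spectral norm) and $\|X\|_{\star,\delta}=\sup_{\|Y\|_{\circ,\delta}\le1}\langle Y,X\rangle$ (incoherent nuclear norm). $\mathcal{L}_j(X)\subseteq\mathbb{R}^{d_j}$ is the span of the mode-$j$ fibers $X(a_1,\dots,a_{j-1},\cdot,a_{j+1},\dots,a_k)$; $P_j=P_j(X)$ is the orthogonal projection of $\mathbb{R}^{d_j}$ onto $\mathcal{L}_j(X)$, and $P_j^\perp=I-P_j$. A tensor product of matrices $M_1\otimes\cdots\otimes M_k$ acts linearly on tensors by $u_1\otimes\cdots\otimes u_k\mapsto M_1u_1\otimes\cdots\otimes M_ku_k$. Set $$\mathcal{Q}_X^0=P_1\otimes\cdots\otimes P_k,\qquad\mathcal{Q}_X=\mathcal{Q}_X^0+\sum_{j=1}^kP_1\otimes\cdots\otimes P_{j-1}\otimes P_j^\perp\otimes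 P_{j+1}\otimes\cdots\otimes P_k,\qquad\mathcal{Q}_X^\perp=\mathcal{I}-\mathcal{Q}_X,$$ with $\mathcal{I}$ the identity operator.
   Formalization: The formal theorem assumes X ≠ 0 and k ≥ 2: for X = 0 all P_j vanish, so Q⁰_X W_0 = W_0 forces W_0 = 0, contradicting the norm of W_0 being 1; for k = 1 the set U(δ) is empty and 2/(k(k-1)) is undefined. *)

theory Defs
  imports "HOL-Analysis.Analysis" "HOL-Library.Function_Algebras"
begin

text \<open>Pointwise real vector space structure on functions, so that the library's
  \<^const>\<open>span\<close> and \<^const>\<open>linear\<close> apply to coordinate vectors and tensors.\<close>

instantiation "fun" :: (type, real_vector) real_vector
begin

definition scaleR_fun :: "real \<Rightarrow> ('a \<Rightarrow> 'b) \<Rightarrow> 'a \<Rightarrow> 'b"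
  where "scaleR_fun r f = (\<lambda>x. r *\<^sub>R f x)"

instance
  by standard (simp_all add: scaleR_fun_def fun_eq_iff algebra_simps)

end

lemma scaleR_fun_apply [simp]: "(r *\<^sub>R f) x = r *\<^sub>R f x"
  by (simp add: scaleR_fun_def)

text \<open>Modes and coordinates are numbered from 0.  A vector in $R^n$ is a function that vanishes
  outside \<open>{..<n}\<close>; a tensor in $R^{d_1 \times \dots \times d_k}$ is a function that vanishes
  outside the multi-indices \<open>idx k d\<close>.  Such functions form linear subspaces of the function
  spaces, and they are equal iff they agree in all coordinates.\<close>

definition vecs :: "nat \<Rightarrow> (nat \<Rightarrow> real) set"
  where "vecs n = {u. \<forall>i. i \<notin> {..<n} \<longrightarrow> u i = 0}"

definition idx :: "nat \<Rightarrow> (nat \<Rightarrow> nat) \<Rightarrow> (nat \<Rightarrow> nat) set"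
  where "idx k d = (\<Pi>\<^sub>E j\<in>{..<k}. {..<d j})"

type_synonym tensor = "(nat \<Rightarrow> nat) \<Rightarrow> real"

definition tensors :: "nat \<Rightarrow> (nat \<Rightarrow> nat) \<Rightarrow> tensor set"
  where "tensors k d = {X. \<forall>a. a \<notin> idx k d \<longrightarrow> X a = 0}"

definition ip :: "'a set \<Rightarrow> ('a \<Rightarrow> real) \<Rightarrow> ('a \<Rightarrow> real) \<Rightarrow> real"
  where "ip A f g = (\<Sum>a\<in>A. f a * g a)"

abbreviation tip :: "nat \<Rightarrow> (nat \<Rightarrow> nat) \<Rightarrow> tensor \<Rightarrow> tensor \<Rightarrow> real"
  where "tip k d \<equiv> ip (idx k d)"

abbreviation norm_l2 :: "nat \<Rightarrow> (nat \<Rightarrow> real) \<Rightarrow> real"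
  where "norm_l2 n u \<equiv> L2_set u {..<n}"

text \<open>Only meaningful for \<open>n > 0\<close>; all dimensions are positive as soon as a nonzero tensor
  exists.\<close>

definition norm_linf :: "nat \<Rightarrow> (nat \<Rightarrow> real) \<Rightarrow> real"
  where "norm_linf n u = (MAX i\<in>{..<n}. \<bar>u i\<bar>)"

definition outer :: "nat \<Rightarrow> (nat \<Rightarrow> nat) \<Rightarrow> (nat \<Rightarrow> nat \<Rightarrow> real) \<Rightarrow> tensor"
  where "outer k d u = (\<lambda>a. if a \<in> idx k d then \<Prod>j<k. u j (a j) else 0)"


subsection \<open>Incoherent norms\<close>

definition incoh_pair ::
    "nat \<Rightarrow> (nat \<Rightarrow> nat) \<Rightarrow> (nat \<Rightarrow> real) \<Rightarrow> nat \<Rightarrow> nat \<Rightarrow> tensor set"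
  where "incoh_pair k d \<delta> j1 j2 =
    {outer k d u | u. (\<forall>j<k. u j \<in> vecs (d j) \<and> norm_l2 (d j) (u j) \<le> 1) \<and>
                      (\<forall>j<k. j \<noteq> j1 \<and> j \<noteq> j2 \<longrightarrow> norm_linf (d j) (u j) \<le> \<delta> j)}"

definition incoh :: "nat \<Rightarrow> (nat \<Rightarrow> nat) \<Rightarrow> (nat \<Rightarrow> real) \<Rightarrow> tensor set"
  where "incoh k d \<delta> = (\<Union>j2<k. \<Union>j1<j2. incoh_pair k d \<delta> j1 j2)"

text \<open>Both suprema are over nonempty bounded sets when \<open>k \<ge> 2\<close>, all \<open>d j > 0\<close> and all
  \<open>\<delta> j > 0\<close>; see \<open>bdd_above_spectral\<close> and \<open>bdd_above_nuclear\<close> below.\<close>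

definition incoh_spectral :: "nat \<Rightarrow> (nat \<Rightarrow> nat) \<Rightarrow> (nat \<Rightarrow> real) \<Rightarrow> tensor \<Rightarrow> real"
  where "incoh_spectral k d \<delta> X = (SUP Y\<in>incoh k d \<delta>. tip k d Y X)"

definition incoh_nuclear :: "nat \<Rightarrow> (nat \<Rightarrow> nat) \<Rightarrow> (nat \<Rightarrow> real) \<Rightarrow> tensor \<Rightarrow> real"
  where "incoh_nuclear k d \<delta> X =
    (SUP Y\<in>{Y \<in> tensors k d. incoh_spectral k d \<delta> Y \<le> 1}. tip k d Y X)"


subsection \<open>Fiber spaces, projections and tensor products of linear maps\<close>

definition fiber :: "tensor \<Rightarrow> nat \<Rightarrow> (nat \<Rightarrow> nat) \<Rightarrow> nat \<Rightarrow> real"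
  where "fiber X j a = (\<lambda>i. X (a(j := i)))"

definition fiber_space :: "nat \<Rightarrow> (nat \<Rightarrow> nat) \<Rightarrow> tensor \<Rightarrow> nat \<Rightarrow> (nat \<Rightarrow> real) set"
  where "fiber_space k d X j = span (fiber X j ` idx k d)"

definition orth_proj :: "nat \<Rightarrow> (nat \<Rightarrow> real) set \<Rightarrow> (nat \<Rightarrow> real) \<Rightarrow> nat \<Rightarrow> real"
  where "orth_proj n L u = (THE v. v \<in> L \<and> (\<forall>w\<in>L. ip {..<n} (u - v) w = 0))"

definition P :: "nat \<Rightarrow> (nat \<Rightarrow> nat) \<Rightarrow> tensor \<Rightarrow> nat \<Rightarrow> (nat \<Rightarrow> real) \<Rightarrow> nat \<Rightarrow> real"
  where "P k d X j = orth_proj (d j) (fiber_space k d X j)"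

definition Pperp :: "nat \<Rightarrow> (nat \<Rightarrow> nat) \<Rightarrow> tensor \<Rightarrow> nat \<Rightarrow> (nat \<Rightarrow> real) \<Rightarrow> nat \<Rightarrow> real"
  where "Pperp k d X j u = u - P k d X j u"

definition unit_vec :: "nat \<Rightarrow> nat \<Rightarrow> real"
  where "unit_vec i = (\<lambda>m. of_bool (m = i))"

text \<open>The tensor product $M_1 \otimes \dots \otimes M_k$ of linear maps, as the linear map that
  sends the basis tensor $e_{b_1} \otimes \dots \otimes e_{b_k}$ to
  $M_1 e_{b_1} \otimes \dots \otimes M_k e_{b_k}$; by \<open>tensor_map_outer\<close> below it acts in the same
  way on every rank-one tensor.\<close>

definition tensor_map ::
    "nat \<Rightarrow> (nat \<Rightarrow> nat) \<Rightarrow> (nat \<Rightarrow> (nat \<Rightarrow> real) \<Rightarrow> nat \<Rightarrow> real) \<Rightarrow> tensor \<Rightarrow> tensor"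
  where "tensor_map k d M T =
    (\<Sum>b\<in>idx k d. T b *\<^sub>R outer k d (\<lambda>j. M j (unit_vec (b j))))"

definition Q0 :: "nat \<Rightarrow> (nat \<Rightarrow> nat) \<Rightarrow> tensor \<Rightarrow> tensor \<Rightarrow> tensor"
  where "Q0 k d X = tensor_map k d (P k d X)"

definition Q :: "nat \<Rightarrow> (nat \<Rightarrow> nat) \<Rightarrow> tensor \<Rightarrow> tensor \<Rightarrow> tensor"
  where "Q k d X T =
    Q0 k d X T + (\<Sum>j<k. tensor_map k d ((P k d X)(j := Pperp k d X j)) T)"

definition Qperp :: "nat \<Rightarrow> (nat \<Rightarrow> nat) \<Rightarrow> tensor \<Rightarrow> tensor \<Rightarrow> tensor"
  where "Qperp k d X T = T - Q k d X T"


subsection \<open>Well-definedness\<close>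

lemma finite_idx [simp]: "finite (idx k d)"
  by (auto simp: idx_def intro: finite_PiE)

lemma sum_fun_apply: "(\<Sum>a\<in>A. f a) x = (\<Sum>a\<in>A. f a x)"
  by (induction A rule: infinite_finite_induct) auto

lemma unit_vec_expansion:
  assumes "u \<in> vecs n"
  shows "u = (\<Sum>i<n. u i *\<^sub>R unit_vec i)"
proof
  fix m
  have "(\<Sum>i<n. u i * of_bool (m = i)) = (\<Sum>i<n. if m = i then u i else 0)"
    by (rule sum.cong) auto
  then show "u m = (\<Sum>i<n. u i *\<^sub>R unit_vec i) m"
    using assms by (simp add: sum_fun_apply unit_vec_def vecs_def)
qed

lemma tensor_map_outer:
  assumes lin: "\<And>j. j < k \<Longrightarrow> linear (M j)"
    and u: "\<And>j. j < k \<Longrightarrow> u j \<in> vecs (d j)"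
  shows "tensor_map k d M (outer k d u) = outer k d (\<lambda>j. M j (u j))"
proof
  fix a
  show "tensor_map k d M (outer k d u) a = outer k d (\<lambda>j. M j (u j)) a"
  proof (cases "a \<in> idx k d")
    case False
    then show ?thesis by (simp add: tensor_map_def sum_fun_apply outer_def)
  next
    case True
    have M: "M j (u j) m = (\<Sum>i<d j. u j i * M j (unit_vec i) m)" if j: "j < k" for j m
    proof -
      have "M j (u j) = M j (\<Sum>i<d j. u j i *\<^sub>R unit_vec i)"
        by (rule arg_cong[OF unit_vec_expansion[OF u[OF j]]])
      also have "\<dots> = (\<Sum>i<d j. u j i *\<^sub>R M j (unit_vec i))"
        by (simp add: linear_sum[OF lin[OF j]] linear_scale[OF lin[OF j]])
      finally show ?thesis by (simp add: sum_fun_apply)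
    qed
    have "tensor_map k d M (outer k d u) a =
        (\<Sum>b\<in>idx k d. \<Prod>j<k. u j (b j) * M j (unit_vec (b j)) (a j))"
      using True by (simp add: tensor_map_def sum_fun_apply outer_def prod.distrib)
    also have "\<dots> = (\<Prod>j<k. \<Sum>i<d j. u j i * M j (unit_vec i) (a j))"
      unfolding idx_def by (rule prod_sum_PiE [symmetric]) auto
    also have "\<dots> = outer k d (\<lambda>j. M j (u j)) a"
      using True by (simp add: outer_def M)
    finally show ?thesis .
  qed
qed

lemma bdd_above_spectral: "bdd_above ((\<lambda>Y. tip k d Y X) ` incoh k d \<delta>)"
proof (rule bdd_aboveI2)
  fix Y assume "Y \<in> incoh k d \<delta>"
  then obtain u where Y: "Y = outer k d u" and u: "\<And>j. j < k \<Longrightarrow> norm_l2 (d j) (u j) \<le> 1"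
    by (auto simp: incoh_def incoh_pair_def)
  have "Y a * X a \<le> \<bar>X a\<bar>" if a: "a \<in> idx k d" for a
  proof -
    have "\<bar>u j (a j)\<bar> \<le> 1" if j: "j < k" for j
    proof -
      have "a j \<in> {..<d j}" using a j by (auto simp: idx_def PiE_iff)
      then have "\<bar>u j (a j)\<bar> \<le> norm_l2 (d j) (\<lambda>i. \<bar>u j i\<bar>)"
        by (intro member_le_L2_set) auto
      then have "\<bar>u j (a j)\<bar> \<le> norm_l2 (d j) (u j)" by (simp add: L2_set_def)
      then show ?thesis using u[OF j] by simp
    qed
    then have "\<bar>Y a\<bar> \<le> 1"
      using a by (auto simp: Y outer_def abs_prod intro!: prod_le_1)
    then show ?thesis
      by (metis abs_ge_self abs_ge_zero abs_mult mult_left_le_one_le order_trans)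
  qed
  then show "tip k d Y X \<le> (\<Sum>a\<in>idx k d. \<bar>X a\<bar>)"
    unfolding ip_def by (intro sum_mono) auto
qed

lemma bdd_above_nuclear:
  assumes "k \<ge> 2" and \<delta>: "\<And>j. j < k \<Longrightarrow> 0 < \<delta> j \<and> \<delta> j \<le> 1"
  shows "bdd_above ((\<lambda>Y. tip k d Y X) ` {Y \<in> tensors k d. incoh_spectral k d \<delta> Y \<le> 1})"
proof (rule bdd_aboveI2)
  fix Y assume "Y \<in> {Y \<in> tensors k d. incoh_spectral k d \<delta> Y \<le> 1}"
  then have Y: "incoh_spectral k d \<delta> Y \<le> 1" by simp
  define c where "c = (\<Prod>j<k. \<delta> j)"
  have c: "c > 0" using \<delta> by (auto simp: c_def intro: prod_pos)
  have le: "s * c * Y a \<le> 1" if a: "a \<in> idx k d" and s: "\<bar>s\<bar> = 1" for a s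
  proof -
    define u where "u = (\<lambda>j. (if j = 0 then s * \<delta> j else \<delta> j) *\<^sub>R unit_vec (a j))"
    have aj: "a j < d j" if "j < k" for j
      using a that by (auto simp: idx_def PiE_iff)
    have l2: "norm_l2 (d j) (u j) = \<delta> j" if j: "j < k" for j
    proof -
      have "(\<Sum>i<d j. (u j i)\<^sup>2) = (\<Sum>i<d j. if i = a j then (\<delta> j)\<^sup>2 else 0)"
        using s by (intro sum.cong refl)
          (auto simp: u_def unit_vec_def power_mult_distrib power2_eq_1_iff abs_if split: if_splits)
      also have "\<dots> = (\<delta> j)\<^sup>2" using aj[OF j] by simp
      finally show ?thesis using \<delta>[OF j] by (simp add: L2_set_def)
    qed
    have linf: "norm_linf (d j) (u j) \<le> \<delta> j" if j: "j < k" for j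
      unfolding norm_linf_def
      using aj[OF j] \<delta>[OF j] s
      by (subst Max_le_iff) (auto simp: u_def unit_vec_def abs_mult)
    have "u j \<in> vecs (d j)" if "j < k" for j
      using aj[OF that] by (auto simp: u_def vecs_def unit_vec_def)
    then have "outer k d u \<in> incoh_pair k d \<delta> 0 1"
      unfolding incoh_pair_def using l2 linf \<delta> by auto
    then have "outer k d u \<in> incoh k d \<delta>"
      unfolding incoh_def using assms(1) by (intro UN_I[of 1] UN_I[of 0]) auto
    then have "tip k d (outer k d u) Y \<le> 1"
      using Y cSUP_upper[OF _ bdd_above_spectral] unfolding incoh_spectral_def
      by (meson order_trans)
    moreover have "outer k d u b = (if b = a then s * c else 0)" if b: "b \<in> idx k d" for b
    proof (cases "b = a")
      case True
      have "(\<Prod>j<k. u j (a j)) = (\<Prod>j<k. (if j = 0 then s else 1) * \<delta> j)"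
        by (intro prod.cong) (auto simp: u_def unit_vec_def)
      also have "\<dots> = s * c"
        using assms(1) by (simp add: prod.distrib c_def)
      finally show ?thesis using True a by (simp add: outer_def)
    next
      case False
      then obtain j where "j < k" "b j \<noteq> a j"
        using a b unfolding idx_def by (metis PiE_ext lessThan_iff)
      then have "(\<Prod>j<k. u j (b j)) = 0"
        by (auto simp: u_def unit_vec_def intro!: bexI[of _ j])
      then show ?thesis using False by (simp add: outer_def)
    qed
    then have "tip k d (outer k d u) Y = (\<Sum>b\<in>idx k d. if b = a then s * c * Y a else 0)"
      unfolding ip_def by (intro sum.cong) auto
    ultimately show ?thesis using a by simp
  qed
  have "Y a * X a \<le> \<bar>X a\<bar> / c" if a: "a \<in> idx k d" for a
  proof -
    have "c * \<bar>Y a\<bar> \<le> 1"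
      using le[OF a, of 1] le[OF a, of "-1"] by (auto simp: abs_if)
    then have "\<bar>Y a\<bar> \<le> 1 / c" using c by (simp add: field_simps)
    then have "\<bar>Y a\<bar> * \<bar>X a\<bar> \<le> 1 / c * \<bar>X a\<bar>" by (rule mult_right_mono) simp
    then show ?thesis using abs_ge_self[of "Y a * X a"] by (simp add: abs_mult)
  qed
  then show "tip k d Y X \<le> (\<Sum>a\<in>idx k d. \<bar>X a\<bar> / c)"
    unfolding ip_def by (intro sum_mono) auto
qed

lemma ip_linear: "linear (\<lambda>f. ip A f g)"
  by standard (simp_all add: ip_def sum.distrib algebra_simps sum_distrib_left)

lemma ip_commute: "ip A f g = ip A g f"
  by (simp add: ip_def mult.commute)

lemma ip_self_eq_0: "u \<in> vecs n \<Longrightarrow> ip {..<n} u u = 0 \<longleftrightarrow> u = 0"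
  by (auto simp: ip_def vecs_def sum_nonneg_eq_0_iff fun_eq_iff)

lemma subspace_vecs: "subspace (vecs n)"
  by (auto simp: subspace_def vecs_def)

lemma orth_proj_exists:
  assumes "finite B" "B \<subseteq> vecs n"
  shows "\<exists>v\<in>span B. \<forall>w\<in>span B. ip {..<n} (u - v) w = 0"
  using assms
proof (induction B arbitrary: u)
  case empty
  show ?case by (simp add: ip_def)
next
  case (insert b B)
  let ?ip = "ip {..<n}"
  obtain p where p: "p \<in> span B" "\<And>w. w \<in> span B \<Longrightarrow> ?ip (u - p) w = 0"
    using insert by blast
  obtain q where q: "q \<in> span B" "\<And>w. w \<in> span B \<Longrightarrow> ?ip (b - q) w = 0"
    using insert by blast
  define c where "c = b - q"
  define t where "t = ?ip (u - p) c / ?ip c c"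
  define v where "v = p + t *\<^sub>R c"
  have sub: "span B \<subseteq> span (insert b B)" by (rule span_mono) auto
  have "b \<in> span (insert b B)" by (simp add: span_base)
  then have "c \<in> span (insert b B)" unfolding c_def using q(1) sub by (blast intro: span_diff)
  then have v: "v \<in> span (insert b B)" unfolding v_def using p(1) sub
    by (blast intro: span_add span_scale)
  have "c \<in> vecs n"
    using \<open>c \<in> span (insert b B)\<close> insert.prems span_minimal[OF _ subspace_vecs] by blast
  then have tc: "?ip (u - v) c = 0"
    using ip_self_eq_0[of c n] ip_commute[of "{..<n}" "u - v" 0]
    by (cases "c = 0") (simp_all add: v_def t_def linear_diff[OF ip_linear]
        linear_add[OF ip_linear] linear_scale[OF ip_linear] linear_0[OF ip_linear])
  have tB: "?ip (u - v) w = 0" if "w \<in> span B" for w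
    using p(2)[OF that] q(2)[OF that]
    by (simp add: v_def c_def linear_diff[OF ip_linear] linear_add[OF ip_linear]
        linear_scale[OF ip_linear])
  have "?ip (u - v) w = 0" if w: "w \<in> span (insert b B)" for w
  proof -
    obtain r where "w - r *\<^sub>R b \<in> span B" using w by (auto simp: span_insert)
    then have "(w - r *\<^sub>R b) + r *\<^sub>R q \<in> span B" using q(1) by (intro span_add span_scale)
    moreover have "w = ((w - r *\<^sub>R b) + r *\<^sub>R q) + r *\<^sub>R c" by (simp add: c_def algebra_simps)
    ultimately show ?thesis using tB tc
      by (metis (no_types, lifting) add.right_neutral ip_commute ip_linear linear_add linear_scale
          scaleR_zero_right)
  qed
  then show ?case using v by blast
qed

lemma fiber_space_vecs:
  assumes "X \<in> tensors k d" "j < k"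
  shows "fiber X j ` idx k d \<subseteq> vecs (d j)"
proof -
  have "a(j := i) \<notin> idx k d" if "\<not> i < d j" for a i
    using that assms(2) by (auto simp: idx_def PiE_iff intro!: bexI[of _ j])
  then show ?thesis using assms(1) by (auto simp: vecs_def fiber_def tensors_def)
qed

lemma P_iff:
  assumes "X \<in> tensors k d" "j < k"
  shows "P k d X j u = v \<longleftrightarrow>
    v \<in> fiber_space k d X j \<and> (\<forall>w\<in>fiber_space k d X j. ip {..<d j} (u - v) w = 0)"
proof -
  let ?L = "fiber_space k d X j"
  let ?proj = "\<lambda>v. v \<in> ?L \<and> (\<forall>w\<in>?L. ip {..<d j} (u - v) w = 0)"
  have B: "fiber X j ` idx k d \<subseteq> vecs (d j)" by (rule fiber_space_vecs[OF assms])
  have L: "?L \<subseteq> vecs (d j)"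
    unfolding fiber_space_def by (rule span_minimal[OF B subspace_vecs])
  have unique: "v = v'" if v: "?proj v" "?proj v'" for v v'
  proof -
    have m: "v - v' \<in> ?L" using v unfolding fiber_space_def by (blast intro: span_diff)
    have "v - v' = (u - v') - (u - v)" by simp
    then have "ip {..<d j} (v - v') (v - v') = 0"
      using v m by (simp only: linear_diff[OF ip_linear])
    then show ?thesis using ip_self_eq_0[of "v - v'" "d j"] m L by auto
  qed
  have "\<exists>v. ?proj v"
    unfolding fiber_space_def using orth_proj_exists[OF _ B, of u] by auto
  then have ex1: "\<exists>!v. ?proj v" using unique by blast
  have "?proj (P k d X j u)" unfolding P_def orth_proj_def by (rule theI'[OF ex1])
  then show ?thesis using unique by blast
qed

lemma linear_P:
  assumes "X \<in> tensors k d" "j < k"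
  shows "linear (P k d X j)"
proof -
  let ?L = "fiber_space k d X j" and ?P = "P k d X j"
  have P: "?P u \<in> ?L" "w \<in> ?L \<Longrightarrow> ip {..<d j} (?P u) w = ip {..<d j} u w" for u w
    using P_iff[OF assms, of u "?P u"] by (auto simp: linear_diff[OF ip_linear])
  show ?thesis
  proof
    show "?P (u + v) = ?P u + ?P v" for u v
      using P unfolding P_iff[OF assms]
      by (auto simp: fiber_space_def linear_diff[OF ip_linear] linear_add[OF ip_linear]
          intro: span_add)
    show "?P (r *\<^sub>R u) = r *\<^sub>R ?P u" for r u
      using P unfolding P_iff[OF assms]
      by (auto simp: fiber_space_def linear_diff[OF ip_linear] linear_scale[OF ip_linear]
          intro: span_scale)
  qed
qed

lemma linear_Pperp:
  assumes "X \<in> tensors k d" "j < k"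
  shows "linear (Pperp k d X j)"
  using linear_compose_sub[OF linear_ident linear_P[OF assms]]
  by (simp add: Pperp_def[abs_def])

lemma bdd_above_P:
  assumes X: "X \<in> tensors k d" "j < k" and "d j > 0"
  shows "bdd_above ((\<lambda>u. norm_linf (d j) (P k d X j u)) ` {u \<in> vecs (d j). norm_l2 (d j) u \<le> 1})"
proof (rule bdd_aboveI2)
  fix u assume u: "u \<in> {u \<in> vecs (d j). norm_l2 (d j) u \<le> 1}"
  let ?v = "P k d X j u" and ?l2 = "norm_l2 (d j)"
  have "ip {..<d j} u ?v = ip {..<d j} ?v ?v"
    using P_iff[OF X, of u ?v] by (auto simp: linear_diff[OF ip_linear])
  moreover have "ip {..<d j} ?v ?v = (?l2 ?v)\<^sup>2"
    by (simp add: ip_def L2_set_def sum_nonneg power2_eq_square)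
  moreover have "ip {..<d j} u ?v \<le> ?l2 u * ?l2 ?v"
    unfolding ip_def
    by (rule order_trans[OF sum_mono L2_set_mult_ineq]) (simp flip: abs_mult)
  ultimately have "?l2 ?v * ?l2 ?v \<le> ?l2 u * ?l2 ?v" by (simp add: power2_eq_square)
  moreover have "?l2 u * ?l2 ?v \<le> 1 * ?l2 ?v" using u by (intro mult_right_mono) auto
  ultimately have v: "?l2 ?v \<le> 1"
    using mult_le_cancel_right[of "?l2 ?v" "?l2 ?v" 1] L2_set_nonneg[of ?v "{..<d j}"]
    by linarith
  have "\<bar>?v i\<bar> \<le> 1" if "i < d j" for i
  proof -
    have "\<bar>?v i\<bar> \<le> ?l2 (\<lambda>i. \<bar>?v i\<bar>)" using that by (intro member_le_L2_set) auto
    then have "\<bar>?v i\<bar> \<le> ?l2 ?v" by (simp add: L2_set_def)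
    then show ?thesis using v by simp
  qed
  then show "norm_linf (d j) ?v \<le> 1"
    unfolding norm_linf_def using \<open>d j > 0\<close> by (subst Max_le_iff) auto
qed

end

theory Submission
  imports Defs
begin

text \<open>For \<open>W\<close> attaining the supremum that defines the nuclear norm of \<open>X\<close>, take \<open>W0 = Q0 W\<close>: the
  pairing with \<open>X\<close> is unchanged since \<open>Q0\<close> is self-adjoint and fixes \<open>X\<close>, and the spectral norm
  does not grow since projecting a test tensor keeps all its factors short and incoherent.
  The inequality follows by testing the nuclear norm of \<open>Y\<close> against \<open>W0 + c Qperp V\<close> with
  \<open>c = 2 / (k (k - 1))\<close> and an arbitrary \<open>V\<close> of spectral norm at most 1, once this tensor is
  shown to have spectral norm at most 1. On a test tensor \<open>u\<close>, \<open>Qperp\<close> is a sum of \<open>k (k - 1) / 2\<close>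
  rank-one terms indexed by the pairs of modes \<open>i, j\<close> that carry \<open>Pperp\<close>. Each term, paired with \<open>V\<close> and
  added to the pairing of \<open>Q0 u\<close> with \<open>W\<close>, contributes at most
  \<open>|P u_i| |P u_j| + |Pperp u_i| |Pperp u_j|\<close>, which is at most 1 by Cauchy-Schwarz.\<close>

section \<open>Inner products and tensor products of linear maps\<close>

lemma outer_in_tensors: "outer k d u \<in> tensors k d"
  by (simp add: outer_def tensors_def)

lemma subspace_tensors: "subspace (tensors k d)"
  by (auto simp: subspace_def tensors_def)

lemma tensor_map_in_tensors: "tensor_map k d M T \<in> tensors k d"
  unfolding tensor_map_def
  by (intro subspace_sum subspace_scale subspace_tensors outer_in_tensors)

lemma tensors_eqI:
  assumes "S \<in> tensors k d" "T \<in> tensors k d" "\<And>a. a \<in> idx k d \<Longrightarrow> S a = T a"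
  shows "S = T"
proof
  fix a show "S a = T a"
    using assms by (cases "a \<in> idx k d") (auto simp: tensors_def)
qed

lemma idx_lessD: "a \<in> idx k d \<Longrightarrow> j < k \<Longrightarrow> a j < d j"
  by (auto simp: idx_def PiE_iff)

lemma fun_upd_in_idx: "a \<in> idx k d \<Longrightarrow> j < k \<Longrightarrow> i < d j \<Longrightarrow> a(j := i) \<in> idx k d"
  by (auto simp: idx_def PiE_iff extensional_def)

lemma tensor_map_apply:
  "a \<in> idx k d \<Longrightarrow>
    tensor_map k d M T a = (\<Sum>b\<in>idx k d. T b * (\<Prod>j<k. M j (unit_vec (b j)) (a j)))"
  by (simp add: tensor_map_def sum_fun_apply outer_def)

lemma ip_add_left: "ip A (f + f') g = ip A f g + ip A f' g"
  and ip_diff_left: "ip A (f - f') g = ip A f g - ip A f' g"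
  and ip_scale_left: "ip A (r *\<^sub>R f) g = r * ip A f g"
  and ip_sum_left: "ip A (\<Sum>i\<in>I. F i) g = (\<Sum>i\<in>I. ip A (F i) g)"
  by (simp_all add: linear_add[OF ip_linear] linear_diff[OF ip_linear]
      linear_scale[OF ip_linear] linear_sum[OF ip_linear])

lemma ip_add_right: "ip A g (f + f') = ip A g f + ip A g f'"
  and ip_diff_right: "ip A g (f - f') = ip A g f - ip A g f'"
  and ip_scale_right: "ip A g (r *\<^sub>R f) = r * ip A g f"
  and ip_sum_right: "ip A g (\<Sum>i\<in>I. F i) = (\<Sum>i\<in>I. ip A g (F i))"
  by (simp_all add: ip_commute[of A g] ip_add_left ip_diff_left ip_scale_left ip_sum_left)

lemma ip_unit_vec: "b < n \<Longrightarrow> ip {..<n} f (unit_vec b) = f b"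
  by (simp add: ip_def unit_vec_def)

lemma ip_self_eq_norm_l2: "ip {..<n} u u = (norm_l2 n u)\<^sup>2"
  by (simp add: ip_def L2_set_def sum_nonneg power2_eq_square)

text \<open>The kernel of \<open>tensor_map\<close> is the product of the matrix entries of its
  factors, so symmetric factors give a symmetric kernel.\<close>

lemma tensor_map_self_adjoint:
  assumes "\<And>j a b. j < k \<Longrightarrow> a < d j \<Longrightarrow> b < d j \<Longrightarrow> M j (unit_vec a) b = M j (unit_vec b) a"
  shows "tip k d S (tensor_map k d M T) = tip k d (tensor_map k d M S) T"
proof -
  have sym: "(\<Prod>j<k. M j (unit_vec (b j)) (a j)) = (\<Prod>j<k. M j (unit_vec (a j)) (b j))"
    if "a \<in> idx k d" "b \<in> idx k d" for a b
    using that by (intro prod.cong assms) (auto intro: idx_lessD)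
  have "tip k d S (tensor_map k d M T) =
      (\<Sum>a\<in>idx k d. \<Sum>b\<in>idx k d. S a * T b * (\<Prod>j<k. M j (unit_vec (b j)) (a j)))"
    by (simp add: ip_def tensor_map_apply sum_distrib_left mult.assoc)
  also have "\<dots> = (\<Sum>b\<in>idx k d. \<Sum>a\<in>idx k d. S a * T b * (\<Prod>j<k. M j (unit_vec (b j)) (a j)))"
    by (rule sum.swap)
  also have "\<dots> = (\<Sum>b\<in>idx k d. \<Sum>a\<in>idx k d. S a * T b * (\<Prod>j<k. M j (unit_vec (a j)) (b j)))"
    by (intro sum.cong refl arg_cong2[where f="(*)"] sym)
  also have "\<dots> = tip k d (tensor_map k d M S) T"
    by (simp add: ip_def tensor_map_apply sum_distrib_left sum_distrib_right algebra_simps)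
  finally show ?thesis .
qed

text \<open>Each mode-\<open>j\<close> fiber is represented by its multi-index with entry 0 in place
  \<open>j\<close>. If \<open>d j = 0\<close>, both sums are empty.\<close>

lemma sum_idx_split:
  assumes "j < k"
  shows "(\<Sum>a\<in>idx k d. f a) = (\<Sum>a\<in>{a \<in> idx k d. a j = 0}. \<Sum>i<d j. f (a(j := i)))"
proof -
  have "(\<Sum>a\<in>{a \<in> idx k d. a j = 0}. \<Sum>i<d j. f (a(j := i))) =
      (\<Sum>(a, i)\<in>{a \<in> idx k d. a j = 0} \<times> {..<d j}. f (a(j := i)))"
    by (rule sum.cartesian_product)
  also have "\<dots> = (\<Sum>a\<in>idx k d. f a)"
  proof (rule sum.reindex_bij_witness[where j = "\<lambda>(a, i). a(j := i)" and i = "\<lambda>a. (a(j := 0), a j)"])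
    fix p assume p: "p \<in> {a \<in> idx k d. a j = 0} \<times> {..<d j}"
    then show "(((case p of (a, i) \<Rightarrow> a(j := i))(j := 0)),
        (case p of (a, i) \<Rightarrow> a(j := i)) j) = p"
      by (auto simp: fun_eq_iff)
    show "(case p of (a, i) \<Rightarrow> a(j := i)) \<in> idx k d"
      using p assms by (auto intro: fun_upd_in_idx)
  next
    fix a assume a: "a \<in> idx k d"
    have "a j < d j" using a assms by (rule idx_lessD)
    then show "(a(j := 0), a j) \<in> {a \<in> idx k d. a j = 0} \<times> {..<d j}"
      using a assms by (auto intro!: fun_upd_in_idx)
  qed auto
  finally show ?thesis by simp
qed

text \<open>A factor that fixes all mode-\<open>j\<close> fibers may be dropped.\<close>

lemma tensor_map_fix_fibers:
  assumes T: "T \<in> tensors k d" and j: "j < k" and lin: "linear (M j)"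
    and fix_fib: "\<And>b. b \<in> idx k d \<Longrightarrow> M j (fiber T j b) = fiber T j b"
  shows "tensor_map k d M T = tensor_map k d (M(j := \<lambda>u. u)) T"
proof (rule tensors_eqI[OF tensor_map_in_tensors tensor_map_in_tensors])
  fix a assume a: "a \<in> idx k d"
  \<comment> \<open>Summing along the mode-\<open>j\<close> fibers first lets the linear
    \<open>N j\<close> act on a whole fiber, since the entries of the other factors are constant
    along it.\<close>
  have expand: "tensor_map k d N T a =
      (\<Sum>b\<in>{b \<in> idx k d. b j = 0}. (\<Prod>l\<in>{..<k} - {j}. N l (unit_vec (b l)) (a l)) *
         N j (fiber T j b) (a j))" if lin: "linear (N j)" for N
  proof -
    have "tensor_map k d N T a =
        (\<Sum>b\<in>{b \<in> idx k d. b j = 0}. \<Sum>i<d j. T (b(j := i)) *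
           (\<Prod>l<k. N l (unit_vec ((b(j := i)) l)) (a l)))"
      by (simp add: tensor_map_apply[OF a] sum_idx_split[OF j])
    also have "\<dots> = (\<Sum>b\<in>{b \<in> idx k d. b j = 0}. (\<Prod>l\<in>{..<k} - {j}. N l (unit_vec (b l)) (a l)) *
         N j (fiber T j b) (a j))"
    proof (rule sum.cong[OF refl])
      fix b assume b: "b \<in> {b \<in> idx k d. b j = 0}"
      have fv: "fiber T j b \<in> vecs (d j)" using fiber_space_vecs[OF T j] b by auto
      have "N j (fiber T j b) = N j (\<Sum>i<d j. fiber T j b i *\<^sub>R unit_vec i)"
        by (rule arg_cong[OF unit_vec_expansion[OF fv]])
      then have N: "N j (fiber T j b) (a j) = (\<Sum>i<d j. T (b(j := i)) * N j (unit_vec i) (a j))"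
        by (simp add: linear_sum[OF lin] linear_scale[OF lin] sum_fun_apply fiber_def)
      have "(\<Prod>l<k. N l (unit_vec ((b(j := i)) l)) (a l)) =
          N j (unit_vec i) (a j) * (\<Prod>l\<in>{..<k} - {j}. N l (unit_vec (b l)) (a l))" for i
        using j by (subst prod.remove[of _ j]) (auto intro!: prod.cong)
      then show "(\<Sum>i<d j. T (b(j := i)) * (\<Prod>l<k. N l (unit_vec ((b(j := i)) l)) (a l))) =
          (\<Prod>l\<in>{..<k} - {j}. N l (unit_vec (b l)) (a l)) * N j (fiber T j b) (a j)"
        by (simp add: N sum_distrib_left algebra_simps)
    qed
    finally show ?thesis .
  qed
  have lin': "linear ((M(j := \<lambda>u. u)) j)" by (simp add: linear_ident)
  show "tensor_map k d M T a = tensor_map k d (M(j := \<lambda>u. u)) T a"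
    unfolding expand[of M, OF lin] expand[of "M(j := \<lambda>u. u)", OF lin']
    using fix_fib by (auto intro!: sum.cong prod.cong)
qed

lemma tensor_map_ident:
  assumes "T \<in> tensors k d"
  shows "tensor_map k d (\<lambda>_ u. u) T = T"
proof (rule tensors_eqI[OF tensor_map_in_tensors assms])
  fix a assume a: "a \<in> idx k d"
  have "(\<Prod>j<k. unit_vec (b j) (a j)) = of_bool (b = a)" if b: "b \<in> idx k d" for b
  proof (cases "b = a")
    case False
    then obtain j where "j < k" "b j \<noteq> a j"
      using a b unfolding idx_def by (metis PiE_ext lessThan_iff)
    then show ?thesis using False by (auto simp: unit_vec_def intro!: bexI[of _ j])
  qed (simp add: unit_vec_def)
  then have "tensor_map k d (\<lambda>_ u. u) T a = (\<Sum>b\<in>idx k d. T b * of_bool (b = a))"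
    by (simp add: tensor_map_apply[OF a])
  then show "tensor_map k d (\<lambda>_ u. u) T a = T a"
    using a by simp
qed

lemma tensor_map_cong:
  assumes "\<And>j. j < k \<Longrightarrow> M j = N j"
  shows "tensor_map k d M = tensor_map k d N"
proof -
  have "outer k d (\<lambda>j. M j (v j)) = outer k d (\<lambda>j. N j (v j))" for v
    using assms by (auto simp: outer_def fun_eq_iff intro!: prod.cong)
  then show ?thesis by (simp add: tensor_map_def[abs_def])
qed

section \<open>The projections attached to a tensor\<close>

lemma P_vecs:
  assumes "X \<in> tensors k d" "j < k"
  shows "P k d X j u \<in> vecs (d j)"
  using P_iff[OF assms, of u "P k d X j u"] span_minimal[OF fiber_space_vecs[OF assms] subspace_vecs]
  by (auto simp: fiber_space_def)

text \<open>Both sides equal the inner product of the two projections, since residuals are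
  orthogonal to the fiber space.\<close>

lemma P_symmetric:
  assumes "X \<in> tensors k d" "j < k"
  shows "ip {..<d j} (P k d X j u) v = ip {..<d j} u (P k d X j v)"
proof -
  have P: "P k d X j u \<in> fiber_space k d X j"
    "w \<in> fiber_space k d X j \<Longrightarrow> ip {..<d j} (P k d X j u) w = ip {..<d j} u w" for u w
    using P_iff[OF assms, of u "P k d X j u"] by (auto simp: ip_diff_left)
  have "ip {..<d j} (P k d X j u) v = ip {..<d j} (P k d X j v) (P k d X j u)"
    using P(2)[OF P(1)] ip_commute by metis
  also have "\<dots> = ip {..<d j} u (P k d X j v)"
    using P(2)[OF P(1)] ip_commute by metis
  finally show ?thesis .
qed

lemma P_matrix_symmetric:
  assumes "X \<in> tensors k d" "j < k" "a < d j" "b < d j"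
  shows "P k d X j (unit_vec a) b = P k d X j (unit_vec b) a"
  using P_symmetric[OF assms(1,2), of "unit_vec a" "unit_vec b"] assms(3,4)
    ip_commute[of "{..<d j}" "unit_vec a" "P k d X j (unit_vec b)"]
  by (simp add: ip_unit_vec)

lemma Pperp_matrix_symmetric:
  assumes "X \<in> tensors k d" "j < k" "a < d j" "b < d j"
  shows "Pperp k d X j (unit_vec a) b = Pperp k d X j (unit_vec b) a"
  using P_matrix_symmetric[OF assms] by (auto simp: Pperp_def unit_vec_def)

lemma Pperp_vecs:
  assumes "X \<in> tensors k d" "j < k" "u \<in> vecs (d j)"
  shows "Pperp k d X j u \<in> vecs (d j)"
  using P_vecs[OF assms(1,2)] assms(3) by (auto simp: Pperp_def intro: subspace_diff[OF subspace_vecs])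

lemma P_pythagoras:
  assumes "X \<in> tensors k d" "j < k"
  shows "(norm_l2 (d j) (P k d X j u))\<^sup>2 + (norm_l2 (d j) (Pperp k d X j u))\<^sup>2 = (norm_l2 (d j) u)\<^sup>2"
proof -
  have "ip {..<d j} (u - P k d X j u) (P k d X j u) = 0"
    using P_iff[OF assms, of u "P k d X j u"] by auto
  then show ?thesis
    using ip_commute[of "{..<d j}" "P k d X j u" u]
    unfolding Pperp_def ip_self_eq_norm_l2 [symmetric]
    by (simp add: ip_diff_left ip_diff_right)
qed

text \<open>The mode-\<open>j\<close> fibers of \<open>X\<close> lie in the space that
  \<open>P\<close> projects onto, so the factors can be replaced by the identity one mode at a
  time.\<close>

lemma Q0_fixes:
  assumes "X \<in> tensors k d"
  shows "Q0 k d X X = X"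
proof -
  define M where "M n = (\<lambda>j. if j < n then (\<lambda>u. u) else P k d X j)" for n
  have "tensor_map k d (P k d X) X = tensor_map k d (M n) X" if "n \<le> k" for n
    using that
  proof (induction n)
    case 0
    show ?case by (simp add: M_def)
  next
    case (Suc n)
    have n: "n < k" using Suc.prems by simp
    have "P k d X n (fiber X n b) = fiber X n b" if "b \<in> idx k d" for b
      unfolding P_iff[OF assms n] using that by (auto simp: fiber_space_def ip_def intro: span_base)
    then have "tensor_map k d (M n) X = tensor_map k d ((M n)(n := \<lambda>u. u)) X"
      using linear_P[OF assms n] by (intro tensor_map_fix_fibers assms n) (auto simp: M_def)
    moreover have "(M n)(n := \<lambda>u. u) = M (Suc n)" by (auto simp: M_def fun_eq_iff)
    ultimately show ?case using Suc by simp
  qed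
  from this[of k] have "Q0 k d X X = tensor_map k d (M k) X" by (simp add: Q0_def)
  also have "\<dots> = tensor_map k d (\<lambda>_ u. u) X"
    by (intro fun_cong[OF tensor_map_cong]) (simp add: M_def)
  finally show ?thesis using tensor_map_ident[OF assms] by simp
qed

lemma Q0_self_adjoint:
  assumes "X \<in> tensors k d"
  shows "tip k d S (Q0 k d X T) = tip k d (Q0 k d X S) T"
  unfolding Q0_def by (intro tensor_map_self_adjoint P_matrix_symmetric assms)

lemma Qperp_self_adjoint:
  assumes "X \<in> tensors k d"
  shows "tip k d S (Qperp k d X T) = tip k d (Qperp k d X S) T"
proof -
  have "tip k d S (tensor_map k d ((P k d X)(j := Pperp k d X j)) T) =
      tip k d (tensor_map k d ((P k d X)(j := Pperp k d X j)) S) T" for j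
    by (intro tensor_map_self_adjoint)
      (auto simp: P_matrix_symmetric[OF assms] Pperp_matrix_symmetric[OF assms])
  then show ?thesis
    by (simp add: Qperp_def Q_def ip_add_left ip_add_right ip_diff_left ip_diff_right
        ip_sum_left ip_sum_right Q0_self_adjoint[OF assms])
qed

lemma Qperp_in_tensors:
  "T \<in> tensors k d \<Longrightarrow> Qperp k d X T \<in> tensors k d"
  unfolding Qperp_def Q_def Q0_def
  by (intro subspace_diff subspace_add subspace_sum subspace_tensors tensor_map_in_tensors)

section \<open>Expansion of \<open>Qperp\<close> over pairs of modes\<close>

text \<open>The expansion of the product over subsets \<open>A\<close> on which \<open>y\<close> is chosen, grouped by the two
  elements of \<open>A\<close> of least rank.\<close>

lemma prod_add_expand_pairs:
  fixes x y :: "'i \<Rightarrow> 'a::comm_ring_1" and \<rho> :: "'i \<Rightarrow> nat"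
  assumes "finite S" "inj_on \<rho> S"
  shows "(\<Prod>l\<in>S. x l + y l) = (\<Prod>l\<in>S. x l) + (\<Sum>j\<in>S. \<Prod>l\<in>S. if l = j then y l else x l) +
    (\<Sum>j\<in>S. \<Sum>i\<in>{i \<in> S. \<rho> i < \<rho> j}.
       \<Prod>l\<in>S. if l = i \<or> l = j then y l else if \<rho> l < \<rho> j then x l else x l + y l)"
    (is "_ = _ + _ + ?G S")
  using assms
proof (induction S rule: finite_ranking_induct[where f = \<rho>])
  case empty
  show ?case by simp
next
  case (insert m S)
  show ?case
  proof (cases "m \<in> S")
    case True
    then show ?thesis using insert by (simp add: insert_absorb)
  next
    case m: False
    \<comment> \<open>The induction adds elements by nondecreasing rank; as \<open>\<rho>\<close> is
      injective, a new \<open>m\<close> strictly outranks all of \<open>S\<close>.\<close>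
    have less: "\<rho> l < \<rho> m" if "l \<in> S" for l
      using insert.hyps(2)[OF that] insert.prems m that by (auto simp: inj_on_def le_less)
    have ne: "l \<noteq> m" if "l \<in> S" for l using m that by auto
    have fin: "finite {i \<in> S. Q i}" for Q using insert.hyps(1) by simp
    have F: "(\<Sum>j\<in>insert m S. \<Prod>l\<in>insert m S. if l = j then y l else x l) =
        y m * (\<Prod>l\<in>S. x l) + x m * (\<Sum>j\<in>S. \<Prod>l\<in>S. if l = j then y l else x l)"
    proof -
      have "(\<Prod>l\<in>S. if l = m then y l else x l) = (\<Prod>l\<in>S. x l)"
        using m by (intro prod.cong) auto
      moreover have "(\<Prod>l\<in>insert m S. if l = j then y l else x l) =
          x m * (\<Prod>l\<in>S. if l = j then y l else x l)" if "j \<in> S" for j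
        using insert.hyps(1) m that by auto
      ultimately show ?thesis
        using insert.hyps(1) m by (simp add: sum_distrib_left)
    qed
    have sets: "{i \<in> insert m S. \<rho> i < \<rho> m} = S"
      "j \<in> S \<Longrightarrow> {i \<in> insert m S. \<rho> i < \<rho> j} = {i \<in> S. \<rho> i < \<rho> j}" for j
      using less by (auto dest: less_asym)
    \<comment> \<open>In a pair completed by \<open>m\<close>, every other element ranks below
      \<open>m\<close> and contributes \<open>x\<close>.\<close>
    have G1: "(\<Prod>l\<in>insert m S. if l = i \<or> l = m then y l else if \<rho> l < \<rho> m then x l else x l + y l) =
        y m * (\<Prod>l\<in>S. if l = i then y l else x l)" if "i \<in> S" for i
    proof -
      have "(\<Prod>l\<in>S. if l = i \<or> l = m then y l else if \<rho> l < \<rho> m then x l else x l + y l) =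
          (\<Prod>l\<in>S. if l = i then y l else x l)"
        using less ne by (intro prod.cong) auto
      then show ?thesis using insert.hyps(1) m by simp
    qed
    \<comment> \<open>In a pair from \<open>S\<close>, \<open>m\<close> outranks both members, so it
      contributes the unexpanded factor \<open>x m + y m\<close>.\<close>
    have G2: "(\<Prod>l\<in>insert m S. if l = i \<or> l = j then y l else if \<rho> l < \<rho> j then x l else x l + y l) =
        (x m + y m) * (\<Prod>l\<in>S. if l = i \<or> l = j then y l else if \<rho> l < \<rho> j then x l else x l + y l)"
      if "i \<in> S" "j \<in> S" for i j
      using insert.hyps(1) m ne[OF that(1)] ne[OF that(2)] less[OF that(2)] by simp
    have "?G (insert m S) = (\<Sum>i\<in>S. y m * (\<Prod>l\<in>S. if l = i then y l else x l)) +
        (\<Sum>j\<in>S. \<Sum>i\<in>{i \<in> S. \<rho> i < \<rho> j}. (x m + y m) *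
          (\<Prod>l\<in>S. if l = i \<or> l = j then y l else if \<rho> l < \<rho> j then x l else x l + y l))"
      unfolding sum.insert[OF insert.hyps(1) m] sets(1)
      by (intro arg_cong2[where f = "(+)"] sum.cong sets(2) G1 G2) auto
    then have G: "?G (insert m S) =
        y m * (\<Sum>j\<in>S. \<Prod>l\<in>S. if l = j then y l else x l) + (x m + y m) * ?G S"
      by (simp only: sum_distrib_left)
    have IH: "(\<Prod>l\<in>S. x l + y l) = (\<Prod>l\<in>S. x l) +
        (\<Sum>j\<in>S. \<Prod>l\<in>S. if l = j then y l else x l) + ?G S"
      using insert.IH insert.prems by simp
    have E: "(\<Prod>l\<in>insert m S. x l) = x m * (\<Prod>l\<in>S. x l)"
      and L: "(\<Prod>l\<in>insert m S. x l + y l) = (x m + y m) * (\<Prod>l\<in>S. x l + y l)"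
      using insert.hyps(1) m by simp_all
    show ?thesis
      unfolding L E F G IH by (simp only: algebra_simps)
  qed
qed

lemma P_idempotent:
  assumes "X \<in> tensors k d" "j < k"
  shows "P k d X j (P k d X j u) = P k d X j u"
  using P_iff[OF assms, of u "P k d X j u"] unfolding P_iff[OF assms, of "P k d X j u"]
  by (auto simp: ip_def)

lemma tensor_map_linear: "linear (tensor_map k d M)"
  by standard (simp_all add: tensor_map_def sum.distrib scaleR_sum_right algebra_simps)

text \<open>Expanding the inner \<open>Q0\<close> into rank-one tensors reduces the claim to
  idempotence of each \<open>P\<close>.\<close>

lemma Q0_idempotent:
  assumes "X \<in> tensors k d"
  shows "Q0 k d X (Q0 k d X T) = Q0 k d X T"
proof -
  have "Q0 k d X (Q0 k d X T) =
      (\<Sum>b\<in>idx k d. T b *\<^sub>R Q0 k d X (outer k d (\<lambda>j. P k d X j (unit_vec (b j)))))"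
    unfolding Q0_def
    by (subst (2) tensor_map_def)
      (simp only: linear_sum[OF tensor_map_linear] linear_scale[OF tensor_map_linear])
  also have "\<dots> = (\<Sum>b\<in>idx k d. T b *\<^sub>R outer k d (\<lambda>j. P k d X j (P k d X j (unit_vec (b j)))))"
    unfolding Q0_def by (subst tensor_map_outer) (auto simp: linear_P assms P_vecs)
  also have "\<dots> = Q0 k d X T"
    unfolding Q0_def tensor_map_def using assms
    by (intro sum.cong refl arg_cong2[where f = scaleR])
      (auto simp: outer_def P_idempotent fun_eq_iff intro!: prod.cong)
  finally show ?thesis .
qed

lemma Qperp_zero: "Qperp k d X 0 = 0"
  by (simp add: Qperp_def Q_def Q0_def linear_0[OF tensor_map_linear])

text \<open>Split each \<open>u l\<close> into its \<open>P\<close> and \<open>Pperp\<close> parts: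
  \<open>Q\<close> collects the terms with at most one \<open>Pperp\<close>, so \<open>Qperp\<close>
  keeps those with at least two. The ranking is left free so that it can be adapted to each test
  tensor.\<close>

lemma Qperp_outer:
  fixes \<rho> :: "nat \<Rightarrow> nat"
  assumes X: "X \<in> tensors k d" and u: "\<And>j. j < k \<Longrightarrow> u j \<in> vecs (d j)"
    and \<rho>: "inj_on \<rho> {..<k}"
  shows "Qperp k d X (outer k d u) = (\<Sum>j<k. \<Sum>i\<in>{i \<in> {..<k}. \<rho> i < \<rho> j}.
    outer k d (\<lambda>l. if l = i \<or> l = j then Pperp k d X l (u l)
                   else if \<rho> l < \<rho> j then P k d X l (u l) else u l))"
    (is "_ = ?R")
proof (rule tensors_eqI)
  show "Qperp k d X (outer k d u) \<in> tensors k d"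
    by (intro Qperp_in_tensors outer_in_tensors)
  show "?R \<in> tensors k d"
    by (intro subspace_sum subspace_tensors outer_in_tensors)
  fix a assume a: "a \<in> idx k d"
  define x where "x l = P k d X l (u l) (a l)" for l
  define y where "y l = Pperp k d X l (u l) (a l)" for l
  have xy: "u l (a l) = x l + y l" for l by (simp add: x_def y_def Pperp_def)
  have "Q0 k d X (outer k d u) a = (\<Prod>l<k. x l)"
    using a unfolding Q0_def x_def
    by (subst tensor_map_outer[OF linear_P[OF X] u]) (auto simp: outer_def)
  moreover have "tensor_map k d ((P k d X)(j := Pperp k d X j)) (outer k d u) a =
      (\<Prod>l<k. if l = j then y l else x l)" for j
    using a unfolding x_def y_def
    by (subst tensor_map_outer)
      (auto simp: outer_def linear_P[OF X] linear_Pperp[OF X] u intro!: prod.cong)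
  ultimately have "Qperp k d X (outer k d u) a = (\<Prod>l<k. x l + y l) -
      ((\<Prod>l<k. x l) + (\<Sum>j<k. \<Prod>l<k. if l = j then y l else x l))"
    using a by (simp add: Qperp_def Q_def sum_fun_apply outer_def xy)
  also have "\<dots> = (\<Sum>j<k. \<Sum>i\<in>{i \<in> {..<k}. \<rho> i < \<rho> j}.
       \<Prod>l<k. if l = i \<or> l = j then y l else if \<rho> l < \<rho> j then x l else x l + y l)"
    unfolding prod_add_expand_pairs[OF finite_lessThan \<rho>] by simp
  also have "\<dots> = ?R a"
    using a unfolding sum_fun_apply outer_def
    by (auto simp: x_def y_def Pperp_def intro!: sum.cong prod.cong)
  finally show "Qperp k d X (outer k d u) a = ?R a" .
qed

text \<open>An injective ranking orders every pair of distinct elements in exactly one way, so the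
  sum and its transpose together count the ordered pairs off the diagonal.\<close>

lemma sum_ranked_pairs:
  fixes \<rho> :: "'i \<Rightarrow> nat"
  assumes "finite S" "inj_on \<rho> S"
  shows "(\<Sum>j\<in>S. \<Sum>i\<in>{i \<in> S. \<rho> i < \<rho> j}. 1) = real (card S) * (real (card S) - 1) / 2"
proof -
  let ?b = "\<lambda>i j. of_bool (\<rho> i < \<rho> j) :: real"
  have "(\<Sum>j\<in>S. \<Sum>i\<in>{i \<in> S. \<rho> i < \<rho> j}. 1) = (\<Sum>j\<in>S. \<Sum>i\<in>S. ?b i j)"
    unfolding sum.inter_filter[OF assms(1)] of_bool_def ..
  moreover have "(\<Sum>j\<in>S. \<Sum>i\<in>S. ?b i j) = (\<Sum>j\<in>S. \<Sum>i\<in>S. ?b j i)"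
    by (rule sum.swap)
  moreover have "(\<Sum>j\<in>S. \<Sum>i\<in>S. ?b i j) + (\<Sum>j\<in>S. \<Sum>i\<in>S. ?b j i) =
      (\<Sum>j\<in>S. \<Sum>i\<in>S. 1 - (if i = j then 1 else 0))"
    unfolding sum.distrib [symmetric]
    using assms(2) by (intro sum.cong refl) (auto simp: inj_on_def of_bool_def)
  moreover have "\<dots> = real (card S) * (real (card S) - 1)"
    using assms(1) by (simp add: sum_subtractf sum.delta algebra_simps)
  ultimately show ?thesis by simp
qed

section \<open>Incoherent norms\<close>

lemma norm_linf_le_iff:
  "n > 0 \<Longrightarrow> norm_linf n u \<le> c \<longleftrightarrow> (\<forall>i<n. \<bar>u i\<bar> \<le> c)"
  unfolding norm_linf_def by (subst Max_le_iff) auto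

lemma norm_l2_scale: "norm_l2 n (r *\<^sub>R u) = \<bar>r\<bar> * norm_l2 n u"
  by (simp add: L2_set_def power_mult_distrib real_sqrt_mult flip: sum_distrib_left)

lemma zero_in_tensors: "0 \<in> tensors k d"
  by (simp add: tensors_def)

lemma incohI:
  assumes "i < k" "j < k" "i \<noteq> j"
    and "\<And>l. l < k \<Longrightarrow> w l \<in> vecs (d l)" "\<And>l. l < k \<Longrightarrow> norm_l2 (d l) (w l) \<le> 1"
    and "\<And>l. l < k \<Longrightarrow> l \<noteq> i \<Longrightarrow> l \<noteq> j \<Longrightarrow> norm_linf (d l) (w l) \<le> \<delta> l"
  shows "outer k d w \<in> incoh k d \<delta>"
proof -
  have "outer k d w \<in> incoh_pair k d \<delta> (min i j) (max i j)"
    using assms unfolding incoh_pair_def by (auto simp: min_def max_def)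
  moreover have "min i j < max i j" "max i j < k" using assms(1-3) by auto
  ultimately show ?thesis unfolding incoh_def by blast
qed

text \<open>Under these conditions both norms are suprema over nonempty bounded sets.\<close>

locale incoherence =
  fixes k :: nat and d :: "nat \<Rightarrow> nat" and \<delta> :: "nat \<Rightarrow> real"
  assumes k2: "k \<ge> 2"
    and d_pos: "j < k \<Longrightarrow> 0 < d j"
    and delta: "j < k \<Longrightarrow> 0 < \<delta> j \<and> \<delta> j \<le> 1"
begin

abbreviation "spectral \<equiv> incoh_spectral k d \<delta>"
abbreviation "nuclear \<equiv> incoh_nuclear k d \<delta>"

lemma incoh_nonempty: "incoh k d \<delta> \<noteq> {}"
proof -
  have "outer k d (\<lambda>_. 0) \<in> incoh k d \<delta>"
    by (rule incohI[of 0 k 1])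
      (use k2 d_pos delta in \<open>auto simp: vecs_def L2_set_def norm_linf_le_iff less_imp_le\<close>)
  then show ?thesis by blast
qed

lemma spectral_le_iff: "spectral T \<le> c \<longleftrightarrow> (\<forall>Z\<in>incoh k d \<delta>. tip k d Z T \<le> c)"
  unfolding incoh_spectral_def by (rule cSUP_le_iff[OF incoh_nonempty bdd_above_spectral])

lemma spectral_zero_le: "c \<ge> 0 \<Longrightarrow> spectral 0 \<le> c"
  unfolding spectral_le_iff by (simp add: ip_def)

lemma spectral_scale_le:
  assumes "r \<ge> 0" "spectral T \<le> c"
  shows "spectral (r *\<^sub>R T) \<le> r * c"
  using assms unfolding spectral_le_iff by (auto simp: ip_scale_right intro: mult_left_mono)

section \<open>Duality of the two norms\<close>

lemma nuclear_upper:
  assumes "T \<in> tensors k d" "spectral T \<le> 1"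
  shows "tip k d T Y \<le> nuclear Y"
  unfolding incoh_nuclear_def
  by (rule cSUP_upper) (use assms bdd_above_nuclear[OF k2 delta] in auto)

lemma nuclear_least:
  assumes "\<And>T. T \<in> tensors k d \<Longrightarrow> spectral T \<le> 1 \<Longrightarrow> tip k d T Y \<le> c"
  shows "nuclear Y \<le> c"
  unfolding incoh_nuclear_def
  by (rule cSUP_least) (use assms zero_in_tensors spectral_zero_le[of 1] in auto)

text \<open>The spectral unit ball is compact in the product topology, and pairing with
  \<open>X\<close> is continuous.\<close>

lemma nuclear_attained:
  "\<exists>W \<in> tensors k d. spectral W \<le> 1 \<and> nuclear X = tip k d W X"
proof -
  define K where "K = {Y \<in> tensors k d. spectral Y \<le> 1}"
  \<comment> \<open>Pairing with plus and minus a basis tensor bounds each coordinate over the whole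
    ball.\<close>
  have "\<exists>B. \<forall>Y\<in>K. Y a \<in> {-B..B}" for a
  proof (cases "a \<in> idx k d")
    case True
    define e :: tensor where "e = (\<lambda>b. of_bool (b = a))"
    obtain B1 where "\<And>Y. Y \<in> K \<Longrightarrow> tip k d Y e \<le> B1"
      using bdd_above_nuclear[where X = e and d = d and \<delta> = \<delta>, OF k2 delta] unfolding K_def bdd_above_def by auto
    moreover obtain B2 where "\<And>Y. Y \<in> K \<Longrightarrow> tip k d Y (- e) \<le> B2"
      using bdd_above_nuclear[where X = "- e" and d = d and \<delta> = \<delta>, OF k2 delta] unfolding K_def bdd_above_def by auto
    moreover have "tip k d Y e = Y a" "tip k d Y (- e) = - Y a" for Y
      using True by (simp_all add: ip_def e_def sum_negf)
    ultimately have "\<And>Y. Y \<in> K \<Longrightarrow> Y a \<in> {- max B1 B2..max B1 B2}" by (fastforce simp: max_def)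
    then show ?thesis by blast
  next
    case False
    then show ?thesis by (intro exI[of _ 0]) (auto simp: K_def tensors_def)
  qed
  then obtain B where B: "\<And>Y a. Y \<in> K \<Longrightarrow> Y a \<in> {- B a..B a}" by metis
  \<comment> \<open>Tychonoff over all multi-indices; those outside \<open>idx k d\<close> are
    covered too, as tensors vanish there.\<close>
  have "compact (PiE UNIV (\<lambda>a. {- B a..B a}))"
    unfolding compactin_euclidean_iff [symmetric] euclidean_product_topology [symmetric]
      compactin_PiE by (simp add: compactin_euclidean_iff)
  moreover have "closed K"
  proof -
    have coord: "continuous_on UNIV (\<lambda>Y :: tensor. Y a)" for a
      by (rule continuous_on_product_coordinates)
    have "K = (\<Inter>a\<in>- idx k d. {Y. Y a = 0}) \<inter> (\<Inter>Z\<in>incoh k d \<delta>. {Y. tip k d Z Y \<le> 1})"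
      by (auto simp: K_def tensors_def spectral_le_iff)
    also have "closed \<dots>"
      unfolding ip_def
      by (intro closed_Int closed_INT ballI closed_Collect_eq closed_Collect_le continuous_intros coord)
    finally show ?thesis .
  qed
  ultimately have "compact (PiE UNIV (\<lambda>a. {- B a..B a}) \<inter> K)" by (rule compact_Int_closed)
  moreover have "PiE UNIV (\<lambda>a. {- B a..B a}) \<inter> K = K" using B by (auto simp: PiE_iff)
  ultimately have "compact K" by simp
  moreover have "K \<noteq> {}" using zero_in_tensors spectral_zero_le[of 1] by (auto simp: K_def)
  moreover have "continuous_on K (\<lambda>Y. tip k d Y X)"
    unfolding ip_def
    by (intro continuous_intros continuous_on_subset[OF continuous_on_product_coordinates]) auto
  ultimately obtain W where W: "W \<in> K" "\<And>Y. Y \<in> K \<Longrightarrow> tip k d Y X \<le> tip k d W X"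
    using continuous_attains_sup[of K "\<lambda>Y. tip k d Y X"] by blast
  then have "nuclear X = tip k d W X"
    by (intro antisym nuclear_least nuclear_upper) (auto simp: K_def)
  then show ?thesis using W(1) by (auto simp: K_def)
qed

text \<open>A positive multiple of \<open>X\<close> lies in the spectral unit ball and pairs
  positively with \<open>X\<close>.\<close>

lemma nuclear_pos:
  assumes "X \<in> tensors k d" "X \<noteq> 0"
  shows "nuclear X > 0"
proof -
  have "spectral X \<le> 1 + \<bar>spectral X\<bar>" by simp
  \<comment> \<open>The summand 1 and the absolute value make the normalizer positive without
    knowing the sign of \<open>spectral X\<close>.\<close>
  define r where "r = inverse (1 + \<bar>spectral X\<bar>)"
  have r: "r > 0" by (simp add: r_def add_pos_nonneg)
  have "spectral (r *\<^sub>R X) \<le> r * (1 + \<bar>spectral X\<bar>)"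
    using r by (intro spectral_scale_le) auto
  also have "\<dots> = 1" by (simp add: r_def)
  finally have "r * tip k d X X \<le> nuclear X"
    using nuclear_upper[of "r *\<^sub>R X" X] assms(1) subspace_scale[OF subspace_tensors]
    by (auto simp: ip_scale_left)
  moreover have "tip k d X X > 0"
  proof -
    obtain a where a: "X a \<noteq> 0" using assms(2) by (auto simp: fun_eq_iff)
    then have "a \<in> idx k d" using assms(1) by (auto simp: tensors_def)
    then show ?thesis unfolding ip_def
      using a by (intro sum_pos2[of _ a]) (auto simp: zero_less_mult_iff)
  qed
  ultimately show ?thesis using r by (smt (verit) mult_pos_pos)
qed

text \<open>A maximizer strictly inside the ball could be dilated, which would increase its positive
  pairing with \<open>X\<close>.\<close>

lemma spectral_eq_1:
  assumes X: "X \<in> tensors k d" "X \<noteq> 0"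
    and W: "W \<in> tensors k d" "spectral W \<le> 1" "nuclear X = tip k d W X"
  shows "spectral W = 1"
proof (rule ccontr)
  assume "spectral W \<noteq> 1"
  with W(2) have s: "spectral W < 1" by simp
  \<comment> \<open>Truncation at 0 keeps \<open>1 + s\<close> positive; the dilation
    \<open>2 / (1 + s)\<close> exceeds 1 yet keeps the norm at most \<open>2 * s / (1 + s)\<close>,
    which is below 1.\<close>
  define s where "s = max 0 (spectral W)"
  define r where "r = 2 / (1 + s)"
  have s01: "0 \<le> s" "s < 1" using s by (auto simp: s_def)
  then have r: "r > 1" "r * s \<le> 1" by (auto simp: r_def field_simps)
  have "spectral (r *\<^sub>R W) \<le> r * s"
    using r by (intro spectral_scale_le) (auto simp: s_def)
  then have "r * nuclear X \<le> nuclear X"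
    using nuclear_upper[of "r *\<^sub>R W" X] r W subspace_scale[OF subspace_tensors]
    by (auto simp: ip_scale_left)
  then show False using nuclear_pos[OF X] r by simp
qed

text \<open>Normalizing the factors in the two exempt modes \<open>i\<close> and \<open>j\<close>
  yields a test tensor; the bound then follows by homogeneity.\<close>

lemma tip_outer_le_norm_l2:
  assumes ij: "i < k" "j < k" "i \<noteq> j"
    and w: "\<And>l. l < k \<Longrightarrow> w l \<in> vecs (d l)"
    and l2: "\<And>l. l < k \<Longrightarrow> l \<noteq> i \<Longrightarrow> l \<noteq> j \<Longrightarrow> norm_l2 (d l) (w l) \<le> 1"
    and linf: "\<And>l. l < k \<Longrightarrow> l \<noteq> i \<Longrightarrow> l \<noteq> j \<Longrightarrow> norm_linf (d l) (w l) \<le> \<delta> l"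
    and T: "spectral T \<le> 1"
  shows "tip k d (outer k d w) T \<le> norm_l2 (d i) (w i) * norm_l2 (d j) (w j)"
proof (cases "norm_l2 (d i) (w i) = 0 \<or> norm_l2 (d j) (w j) = 0")
  \<comment> \<open>Normalization is impossible here, but a zero factor makes the whole rank-one
    tensor vanish.\<close>
  case True
  then obtain m where m: "m < k" "norm_l2 (d m) (w m) = 0" using ij by auto
  then have "w m (a m) = 0" if "a \<in> idx k d" for a
    using idx_lessD[OF that m(1)] by (simp add: L2_set_eq_0_iff)
  then have "outer k d w a = 0" for a
    using m(1) by (auto simp: outer_def)
  then show ?thesis using True by (auto simp: ip_def)
next
  case False
  define p where "p = inverse (norm_l2 (d i) (w i))"
  define q where "q = inverse (norm_l2 (d j) (w j))"
  have pq: "p > 0" "q > 0" using False by (auto simp: p_def q_def less_le)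
  define v where "v = w(i := p *\<^sub>R w i, j := q *\<^sub>R w j)"
  have "outer k d v \<in> incoh k d \<delta>"
  proof (rule incohI[OF ij])
    fix l assume l: "l < k"
    show "v l \<in> vecs (d l)"
      using w ij l by (auto simp: v_def intro: subspace_scale[OF subspace_vecs])
    show "norm_l2 (d l) (v l) \<le> 1"
      using l2[OF l] False pq by (auto simp: v_def norm_l2_scale p_def q_def)
    show "norm_linf (d l) (v l) \<le> \<delta> l" if "l \<noteq> i" "l \<noteq> j"
      using linf[OF l] that by (simp add: v_def)
  qed
  then have "tip k d (outer k d v) T \<le> 1" using T spectral_le_iff by blast
  moreover have "outer k d v = (p * q) *\<^sub>R outer k d w"
  proof
    fix a
    have "(\<Prod>l<k. v l (a l)) = (\<Prod>l<k. (if l = i then p else 1) * (if l = j then q else 1) * w l (a l))"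
      using ij by (intro prod.cong) (auto simp: v_def)
    also have "\<dots> = p * q * (\<Prod>l<k. w l (a l))"
      using ij by (simp add: prod.distrib)
    finally show "outer k d v a = ((p * q) *\<^sub>R outer k d w) a" by (simp add: outer_def)
  qed
  ultimately have "p * q * tip k d (outer k d w) T \<le> 1" by (simp add: ip_scale_left)
  then show ?thesis using False unfolding p_def q_def
    by (simp add: field_simps zero_less_mult_iff less_le split: if_splits)
qed

text \<open>After ranking the two coherent modes of a test tensor \<open>u\<close> lowest, each summand of
  \<open>Qperp_outer\<close> is incoherent outside the two modes carrying \<open>Pperp\<close>.\<close>

lemma spectral_Q0_plus_Qperp_le:
  assumes X: "X \<in> tensors k d"
    and P_linf: "\<And>j u. j < k \<Longrightarrow> u \<in> vecs (d j) \<Longrightarrow> norm_l2 (d j) u \<le> 1 \<Longrightarrow>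
      norm_linf (d j) (P k d X j u) \<le> \<delta> j"
    and W: "spectral W \<le> 1" and V: "spectral V \<le> 1"
  shows "spectral (Q0 k d X W + (2 / (real k * (real k - 1))) *\<^sub>R Qperp k d X V) \<le> 1"
  unfolding spectral_le_iff
proof
  fix Z assume "Z \<in> incoh k d \<delta>"
  then obtain u j1 j2 where Z: "Z = outer k d u" and j12: "j1 < j2" "j2 < k"
    and u: "\<And>l. l < k \<Longrightarrow> u l \<in> vecs (d l)" and u_l2: "\<And>l. l < k \<Longrightarrow> norm_l2 (d l) (u l) \<le> 1"
    and u_linf: "\<And>l. l < k \<Longrightarrow> l \<noteq> j1 \<Longrightarrow> l \<noteq> j2 \<Longrightarrow> norm_linf (d l) (u l) \<le> \<delta> l"
    unfolding incoh_def incoh_pair_def by blast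
  define c where "c = 2 / (real k * (real k - 1))"
  have c: "c > 0" using k2 by (simp add: c_def)
  \<comment> \<open>The shift by 2 reserves ranks 0 and 1 for the modes in which \<open>u\<close>
    may be coherent.\<close>
  define \<rho> :: "nat \<Rightarrow> nat" where "\<rho> l = (if l = j1 then 0 else if l = j2 then 1 else l + 2)" for l
  have inj: "inj_on \<rho> {..<k}" using j12 by (auto simp: inj_on_def \<rho>_def split: if_splits)
  define pu where "pu l = P k d X l (u l)" for l
  define qu where "qu l = Pperp k d X l (u l)" for l
  define w where "w i j l = (if l = i \<or> l = j then qu l else if \<rho> l < \<rho> j then pu l else u l)" for i j l
  have pu: "pu l \<in> vecs (d l)" "norm_linf (d l) (pu l) \<le> \<delta> l"
    and qu: "qu l \<in> vecs (d l)"
    and pyth: "(norm_l2 (d l) (pu l))\<^sup>2 + (norm_l2 (d l) (qu l))\<^sup>2 \<le> 1" if l: "l < k" for l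
    using P_vecs[OF X l] P_linf[OF l u u_l2] Pperp_vecs[OF X l u] P_pythagoras[OF X l, of "u l"] l
      u_l2[OF l] L2_set_nonneg[of "u l"]
    by (auto simp: pu_def qu_def power_le_one)
  have pu_l2: "norm_l2 (d l) (pu l) \<le> 1" if "l < k" for l
    using pyth[OF that] by (smt (verit) power2_le_imp_le one_power2 zero_le_power2)
  let ?T0 = "tip k d (outer k d pu) W"
  have pair: "?T0 + tip k d (outer k d (w i j)) V \<le> 1"
    if ij: "i < k" "j < k" "\<rho> i < \<rho> j" for i j
  proof -
    have ne: "i \<noteq> j" using ij by auto
    have "norm_l2 (d l) (w i j l) \<le> 1" if "l < k" "l \<noteq> i" "l \<noteq> j" for l
      using that pu_l2 u_l2 by (auto simp: w_def)
    moreover have "norm_linf (d l) (w i j l) \<le> \<delta> l" if l: "l < k" "l \<noteq> i" "l \<noteq> j" for l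
    proof (cases "\<rho> l < \<rho> j")
      case True
      then show ?thesis using l pu by (auto simp: w_def)
    next
      case False
      \<comment> \<open>The mode \<open>l\<close> still carries \<open>u l\<close>. Both
        \<open>i\<close> and \<open>j\<close> rank below it, so its rank is at least 2 and
        \<open>u l\<close> is incoherent.\<close>
      then have "\<rho> j < \<rho> l" using inj l ij by (auto simp: inj_on_def le_less not_less)
      with ij(3) have "l \<noteq> j1" "l \<noteq> j2" by (auto simp: \<rho>_def split: if_splits)
      then show ?thesis using False l u_linf by (auto simp: w_def)
    qed
    ultimately have "tip k d (outer k d (w i j)) V \<le>
        norm_l2 (d i) (w i j i) * norm_l2 (d j) (w i j j)"
      using pu qu u by (intro tip_outer_le_norm_l2 ij ne V) (auto simp: w_def)
    moreover have "?T0 \<le> norm_l2 (d i) (pu i) * norm_l2 (d j) (pu j)"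
      using pu pu_l2 by (intro tip_outer_le_norm_l2 ij ne W) auto
    \<comment> \<open>The pairs of lengths of \<open>pu\<close> and \<open>qu\<close> in modes
      \<open>i\<close> and \<open>j\<close> are plane vectors of length at most 1.\<close>
    moreover have "norm_l2 (d i) (pu i) * norm_l2 (d j) (pu j) +
        norm_l2 (d i) (qu i) * norm_l2 (d j) (qu j) \<le> 1"
      using pyth[OF ij(1)] pyth[OF ij(2)]
        sum_squares_bound[of "norm_l2 (d i) (pu i)" "norm_l2 (d j) (pu j)"]
        sum_squares_bound[of "norm_l2 (d i) (qu i)" "norm_l2 (d j) (qu j)"]
      by linarith
    ultimately show ?thesis by (simp add: w_def)
  qed
  \<comment> \<open>\<open>c\<close> is the reciprocal of the number of pairs, which fixes the
    constant of the theorem.\<close>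
  have count: "(\<Sum>j<k. \<Sum>i\<in>{i \<in> {..<k}. \<rho> i < \<rho> j}. c) = 1"
  proof -
    have "(\<Sum>j<k. \<Sum>i\<in>{i \<in> {..<k}. \<rho> i < \<rho> j}. c) =
        c * (\<Sum>j<k. \<Sum>i\<in>{i \<in> {..<k}. \<rho> i < \<rho> j}. 1)"
      unfolding sum_distrib_left by simp
    also have "\<dots> = 1"
      unfolding sum_ranked_pairs[OF finite_lessThan inj] using k2 by (simp add: c_def)
    finally show ?thesis .
  qed
  have "tip k d Z (Q0 k d X W) = tip k d (Q0 k d X Z) W" by (rule Q0_self_adjoint[OF X])
  also have "Q0 k d X Z = outer k d pu"
    unfolding Q0_def Z pu_def by (rule tensor_map_outer[OF linear_P[OF X] u])
  finally have ZW: "tip k d Z (Q0 k d X W) = ?T0" .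
  have "tip k d Z (Qperp k d X V) = tip k d (Qperp k d X Z) V" by (rule Qperp_self_adjoint[OF X])
  also have "Qperp k d X Z = (\<Sum>j<k. \<Sum>i\<in>{i \<in> {..<k}. \<rho> i < \<rho> j}. outer k d (w i j))"
    unfolding Z w_def pu_def qu_def by (rule Qperp_outer[OF X u inj])
  finally have ZV: "tip k d Z (Qperp k d X V) =
      (\<Sum>j<k. \<Sum>i\<in>{i \<in> {..<k}. \<rho> i < \<rho> j}. tip k d (outer k d (w i j)) V)"
    by (simp only: ip_sum_left)
  \<comment> \<open>Since the weights sum to 1, \<open>?T0\<close> is spread evenly over the pairs,
    one share for each summand of \<open>Qperp\<close>.\<close>
  have "tip k d Z (Q0 k d X W + c *\<^sub>R Qperp k d X V) =
      (\<Sum>j<k. \<Sum>i\<in>{i \<in> {..<k}. \<rho> i < \<rho> j}. c) * ?T0 + c * tip k d Z (Qperp k d X V)"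
    by (simp only: count ip_add_right ip_scale_right ZW mult_1)
  also have "\<dots> = (\<Sum>j<k. \<Sum>i\<in>{i \<in> {..<k}. \<rho> i < \<rho> j}.
      c * (?T0 + tip k d (outer k d (w i j)) V))"
    unfolding ZV sum_distrib_left sum_distrib_right distrib_left sum.distrib ..
  also have "\<dots> \<le> (\<Sum>j<k. \<Sum>i\<in>{i \<in> {..<k}. \<rho> i < \<rho> j}. c * 1)"
    using pair c by (intro sum_mono mult_left_mono) auto
  also have "\<dots> = 1" using count by simp
  finally show "tip k d Z (Q0 k d X W + (2 / (real k * (real k - 1))) *\<^sub>R Qperp k d X V) \<le> 1"
    unfolding c_def .
qed

end

text \<open>The case \<open>X = 0\<close> is excluded because \<open>Q0\<close> is then the zero
  map, and the zero tensor cannot have spectral norm 1 in positive dimensions.\<close>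

theorem theorem1:
  fixes k :: nat and d :: "nat \<Rightarrow> nat" and \<delta> :: "nat \<Rightarrow> real" and X :: tensor
  assumes "k \<ge> 2"
    and "X \<in> tensors k d" and "X \<noteq> 0"
    and "\<And>j. j < k \<Longrightarrow> 0 < \<delta> j \<and> \<delta> j \<le> 1"
    and "\<And>j. j < k \<Longrightarrow>
      (SUP u\<in>{u \<in> vecs (d j). norm_l2 (d j) u \<le> 1}. norm_linf (d j) (P k d X j u)) \<le> \<delta> j"
  shows "\<exists>W0 \<in> tensors k d.
    Q0 k d X W0 = W0 \<and>
    incoh_spectral k d \<delta> W0 = 1 \<and>
    incoh_nuclear k d \<delta> X = tip k d W0 X \<and>
    (\<forall>Y \<in> tensors k d.
      incoh_nuclear k d \<delta> Y \<ge> incoh_nuclear k d \<delta> X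
        + 2 / (real k * (real k - 1)) * incoh_nuclear k d \<delta> (Qperp k d X Y)
        + tip k d W0 (Y - X))"
proof -
  note X = assms(2)
  \<comment> \<open>A nonzero entry gives a multi-index, which forces every dimension to be
    positive.\<close>
  obtain a where "X a \<noteq> 0" using assms(3) by (auto simp: fun_eq_iff)
  then have "a \<in> idx k d" using X by (auto simp: tensors_def)
  then have d_pos: "0 < d j" if "j < k" for j using idx_lessD[of a k d j] that by simp
  interpret incoherence k d \<delta>
    using assms(1,4) d_pos by unfold_locales
  have P_linf: "norm_linf (d j) (P k d X j u) \<le> \<delta> j"
    if "j < k" "u \<in> vecs (d j)" "norm_l2 (d j) u \<le> 1" for j u
    using cSUP_upper[OF _ bdd_above_P[OF X that(1) d_pos[OF that(1)]], of u] that assms(5)[OF that(1)]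
    by force
  obtain W where W: "W \<in> tensors k d" "spectral W \<le> 1" "nuclear X = tip k d W X"
    using nuclear_attained by blast
  define W0 where "W0 = Q0 k d X W"
  define c where "c = 2 / (real k * (real k - 1))"
  have c: "c > 0" using assms(1) by (simp add: c_def)
  have W0: "W0 \<in> tensors k d" unfolding W0_def Q0_def by (rule tensor_map_in_tensors)
  have test: "spectral (W0 + c *\<^sub>R Qperp k d X V) \<le> 1" if "spectral V \<le> 1" for V
    unfolding W0_def c_def by (rule spectral_Q0_plus_Qperp_le[OF X P_linf W(2) that])
  have W0X: "nuclear X = tip k d W0 X"
    unfolding W0_def W(3) ip_commute[of _ _ X] Q0_self_adjoint[OF X] Q0_fixes[OF X] ..
  have "spectral W0 \<le> 1"
    \<comment> \<open>The test tensor for \<open>V = 0\<close> is \<open>W0\<close> itself.\<close>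
    using test[OF spectral_zero_le] Qperp_zero by simp
  then have "spectral W0 = 1" using spectral_eq_1 X assms(3) W0 W0X by blast
  moreover have "Q0 k d X W0 = W0" unfolding W0_def by (rule Q0_idempotent[OF X])
  moreover have "nuclear Y \<ge> nuclear X + c * nuclear (Qperp k d X Y) + tip k d W0 (Y - X)"
    if Y: "Y \<in> tensors k d" for Y
  proof -
    \<comment> \<open>By self-adjointness \<open>Qperp\<close> moves from \<open>Y\<close> to
      \<open>V\<close>, so each test of \<open>Qperp Y\<close> by \<open>V\<close> becomes a test of
      \<open>Y\<close> by \<open>W0 + c Qperp V\<close>. Taking the supremum over \<open>V\<close>
      gives the bound.\<close>
    have "nuclear (Qperp k d X Y) \<le> (nuclear Y - tip k d W0 Y) / c"
    proof (rule nuclear_least)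
      fix V assume V: "V \<in> tensors k d" "spectral V \<le> 1"
      have "W0 + c *\<^sub>R Qperp k d X V \<in> tensors k d"
        by (intro subspace_add subspace_scale subspace_tensors W0 Qperp_in_tensors V)
      then have "tip k d (W0 + c *\<^sub>R Qperp k d X V) Y \<le> nuclear Y"
        using test V by (intro nuclear_upper) auto
      then show "tip k d V (Qperp k d X Y) \<le> (nuclear Y - tip k d W0 Y) / c"
        using c by (simp add: ip_add_left ip_scale_left Qperp_self_adjoint[OF X] field_simps)
    qed
    then show ?thesis using c W0X by (simp add: ip_diff_right field_simps)
  qed
  ultimately show ?thesis using W0 W0X unfolding c_def by blast
qed

end
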